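(* Let $\mathrm{K}_V^{\mathbf t}$ be a complete $\mathbf t$-spread $d$-partite hypergraph. Then the ideal $I(\mathrm{K}_V^{\mathbf t})$ satisfies the $l$-exchange property with respect to the sorting order $<_{\mathrm{sort}}$.
   Context: Setting. Let $n,d\ge 1$ be integers, $[n]=\{1,\dots,n\}$, and let $\mathbf t=(t_1,\dots,t_{d-1})$ be a vector of integers with $t_i\ge 1$ for all $i$. Let $V=\{V_1,\dots,V_d\}$ be a family of nonempty, pairwise disjoint subsets of $[n]$ such that $p<q$ whenever $p\in V_i$, $q\in V_j$ and $i<j$. A $\mathbf t$-spread edge is a set $\{k_1,\dots,k_d\}$ with $k_j\in V_j$ for $j=1,\dots,d$ and $k_j-k_{j-1}\ge t_{j-1}$ for $j=2,\dots,d$. The complete $\mathbf t$-spread $d$-partite hypergraph $\mathrm{K}_V^{\mathbf t}$ is the hypergraph with vertex set $V(\mathrm{K}_V^{\mathbf t})=V_1\cup\dots\cup V_d$ whose edges are all the $\mathbf t$-spread edges. Standing assumption: $\mathrm{K}_V^{\mathbf t}$ has no isolated vertices, i.e. every vertex belongs to at least one edge. Let $\mathbb{K}$ be a field and $S=\mathbb{K}[x_1,\dots,x_n]$. The edge ideal $I(\mathrm{K}_V^{\mathbf t})\subset S$ is the ideal generated by the monomials $x_{k_1}\cdots x_{k_d}$, where $\{k_1,\dots,k_d\}$ runs over the edges of $\mathrm{K}_V^{\mathbf t}$. Let $I\subset S$ be a monomial ideal generated in a single degree $d$ with minimal monomial generating set $\mathcal{G}(I)$. Let $T=\mathbb{K}[t_u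 : u\in\mathcal{G}(I)]$, $\mathbb{K}[I]=\mathbb{K}[u:u\in\mathcal{G}(I)]$, and let $\phi:T\to\mathbb{K}[I]$ be the $\mathbb{K}$-algebra homomorphism with $t_u\mapsto u$. Sorting order: for monomials $u,v$ of degree $d$ write $uv=x_{i_1}\cdots x_{i_{2d}}$ with $i_1\le\dots\le i_{2d}$ and set $\mathrm{sort}(u,v)=(x_{i_1}x_{i_3}\cdots x_{i_{2d-1}},\,x_{i_2}x_{i_4}\cdots x_{i_{2d}})$. The pair $(u,v)$ is sorted if $\mathrm{sort}(u,v)=(u,v)$. The set $\mathcal{G}(I)$ is sortable if $\mathrm{sort}(\mathcal{G}(I)\times\mathcal{G}(I))\subseteq\mathcal{G}(I)\times\mathcal{G}(I)$; the set $\mathcal{G}(I(\mathrm{K}_V^{\mathbf t}))$ is sortable. When $\mathcal{G}(I)$ is sortable, $<_{\mathrm{sort}}$ denotes a monomial order on $T$ (which exists by a theorem of Sturmfels) such that the reduced Gröbner basis of $\ker\phi$ consists of the binomials $t_ut_v-t_{u'}t_{v'}$ with $\mathrm{sort}(u,v)=(u',v')$ and neither $(u,v)$ nor $(v,u)$ sorted, with initial monomial $t_ut_v$. Given a monomial order $<$ on $T$, a monomial of $T$ is a standard monomial of $\ker\phi$ with respect to $<$ if it does not belong to $\mathrm{in}_<(\ker\phi)$. The ideal $I$ satisfies the $l$-exchange property with respect to $<$ if the following holds: whenever $t_{u_1}\cdots t_{u_N}$ and $t_{v_1}\cdots t_{v_N}$ are two standard monomials of $\ker\phi$ with respect to $<$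 (of the same degree $N$) and $q\le n-1$ is such that (i) $\deg_{x_i}(u_1\cdots u_N)=\deg_{x_i}(v_1\cdots v_N)$ for $i=1,\dots,q-1$, and (ii) $\deg_{x_q}(u_1\cdots u_N)<\deg_{x_q}(v_1\cdots v_N)$, then there exist $\alpha\in\{1,\dots,N\}$ and $j$ with $q<j\le n$ such that $x_j$ divides $u_\alpha$ and $x_qu_\alpha/x_j\in I$. *)

theory Defs
  imports "HOL-Library.Poly_Mapping" "HOL-Library.Disjoint_Sets" "HOL-Algebra.Ideal"
begin

section \<open>Polynomial rings\<close>

text \<open>
  A monomial is identified with its exponent vector, so the product of monomials is written
  additively. A polynomial over the field \<^typ>\<open>'k\<close> is a finitely supported map from monomials to
  coefficients, and the type class product on \<^typ>\<open>('v \<Rightarrow>\<^sub>0 nat) \<Rightarrow>\<^sub>0 'k::field\<close> is the product of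
  polynomials. The indeterminates are the elements of a set \<open>X\<close>: for \<open>X = {1..n}\<close> this gives the
  ring \<open>S\<close>; for \<open>X\<close> a set of monomials of \<open>S\<close> it gives the ring \<open>T\<close>.
\<close>

type_synonym 'v mono = "'v \<Rightarrow>\<^sub>0 nat"
type_synonym ('v, 'k) mpoly = "('v \<Rightarrow>\<^sub>0 nat) \<Rightarrow>\<^sub>0 'k"

abbreviation var :: "'v \<Rightarrow> 'v mono" where
  "var x \<equiv> Poly_Mapping.single x 1"

abbreviation deg_in :: "'v mono \<Rightarrow> 'v \<Rightarrow> nat" where
  "deg_in m x \<equiv> Poly_Mapping.lookup m x"

definition monomials :: "'v set \<Rightarrow> 'v mono set" where
  "monomials X = {m. Poly_Mapping.keys m \<subseteq> X}"

definition of_mono :: "'v mono \<Rightarrow> ('v, 'k::field) mpoly" where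
  "of_mono m = Poly_Mapping.single m 1"

definition poly_ring :: "'v set \<Rightarrow> ('v, 'k::field) mpoly ring" where
  "poly_ring X = \<lparr>carrier = {p. Poly_Mapping.keys p \<subseteq> monomials X},
     mult = (*), one = 1, zero = 0, add = (+)\<rparr>"

lemma cring_poly_ring: "cring (poly_ring X :: ('v, 'k::field) mpoly ring)"
proof -
  let ?C = "{p :: ('v, 'k) mpoly. Poly_Mapping.keys p \<subseteq> monomials X}"
  have mon_add: "a + b \<in> monomials X" if "a \<in> monomials X" "b \<in> monomials X" for a b :: "'v mono"
    using that Poly_Mapping.keys_add[of a b] by (auto simp: monomials_def)
  have add: "p + q \<in> ?C" if "p \<in> ?C" "q \<in> ?C" for p q
    using that Poly_Mapping.keys_add[of p q] by auto
  have mult: "p * q \<in> ?C" if "p \<in> ?C" "q \<in> ?C" for p q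
    using that Poly_Mapping.keys_mult[of p q] mon_add by blast
  have one: "1 \<in> ?C"
    by (auto simp: monomials_def)
  have neg: "- p \<in> ?C" if "p \<in> ?C" for p
    using that by simp
  have inv: "\<exists>q\<in>?C. q + p = 0" if "p \<in> ?C" for p
    using neg[OF that] by (intro bexI[of _ "- p"]) auto
  have "abelian_group (poly_ring X :: ('v, 'k) mpoly ring)"
    using add inv
    by (intro abelian_groupI) (auto simp: poly_ring_def algebra_simps)
  moreover have "Group.comm_monoid (poly_ring X :: ('v, 'k) mpoly ring)"
    using mult one by (intro comm_monoidI) (auto simp: poly_ring_def algebra_simps)
  ultimately show ?thesis
    by (intro cringI) (auto simp: poly_ring_def algebra_simps)
qed


section \<open>Monomial orders and Groebner bases\<close>

text \<open>An order is given as a relation on \<^term>\<open>monomials X\<close>; \<open>(a, b) \<in> r\<close> means \<open>a \<le> b\<close>.\<close>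

definition monomial_order :: "'v set \<Rightarrow> 'v mono rel \<Rightarrow> bool" where
  "monomial_order X r \<longleftrightarrow>
     linear_order_on (monomials X) r \<and>
     (\<forall>m\<in>monomials X. (0, m) \<in> r) \<and>
     (\<forall>a\<in>monomials X. \<forall>b\<in>monomials X. \<forall>c\<in>monomials X. (a, b) \<in> r \<longrightarrow> (a + c, b + c) \<in> r)"

definition initial_monomial :: "'v mono rel \<Rightarrow> ('v, 'k::field) mpoly \<Rightarrow> 'v mono" where
  "initial_monomial r p =
     (THE m. m \<in> Poly_Mapping.keys p \<and> (\<forall>m'\<in>Poly_Mapping.keys p. (m', m) \<in> r))"

definition initial_ideal ::
    "'v set \<Rightarrow> 'v mono rel \<Rightarrow> ('v, 'k::field) mpoly set \<Rightarrow> ('v, 'k) mpoly set" where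
  "initial_ideal X r J = Idl\<^bsub>poly_ring X\<^esub> {of_mono (initial_monomial r p) | p. p \<in> J \<and> p \<noteq> 0}"

definition groebner_basis ::
    "'v set \<Rightarrow> 'v mono rel \<Rightarrow> ('v, 'k::field) mpoly set \<Rightarrow> ('v, 'k) mpoly set \<Rightarrow> bool" where
  "groebner_basis X r J B \<longleftrightarrow>
     finite B \<and> B \<subseteq> J \<and> 0 \<notin> B \<and>
     Idl\<^bsub>poly_ring X\<^esub> ((\<lambda>g. of_mono (initial_monomial r g)) ` B) = initial_ideal X r J"

definition reduced_groebner_basis ::
    "'v set \<Rightarrow> 'v mono rel \<Rightarrow> ('v, 'k::field) mpoly set \<Rightarrow> ('v, 'k) mpoly set \<Rightarrow> bool" where
  "reduced_groebner_basis X r J B \<longleftrightarrow>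
     groebner_basis X r J B \<and>
     (\<forall>g\<in>B. Poly_Mapping.lookup g (initial_monomial r g) = 1) \<and>
     (\<forall>g\<in>B. \<forall>h\<in>B. g \<noteq> h \<longrightarrow>
        (\<forall>m\<in>Poly_Mapping.keys h. \<not> (\<exists>c. m = initial_monomial r g + c)))"

definition standard_monomials ::
    "'v set \<Rightarrow> 'v mono rel \<Rightarrow> ('v, 'k::field) mpoly set \<Rightarrow> 'v mono set" where
  "standard_monomials X r J = {m \<in> monomials X. of_mono m \<notin> initial_ideal X r J}"


section \<open>Monomial ideals and their toric ideals\<close>

definition minimal_monomial_generators ::
    "nat \<Rightarrow> (nat, 'k::field) mpoly set \<Rightarrow> nat mono set \<Rightarrow> bool" where
  "minimal_monomial_generators n I G \<longleftrightarrow>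
     G \<subseteq> monomials {1..n} \<and>
     Idl\<^bsub>poly_ring {1..n}\<^esub> (of_mono ` G) = I \<and>
     (\<forall>G'. G' \<subset> G \<longrightarrow> Idl\<^bsub>poly_ring {1..n}\<^esub> (of_mono ` G') \<noteq> I)"

text \<open>A monomial ideal has exactly one minimal set of monomial generators.\<close>

definition gens :: "nat \<Rightarrow> (nat, 'k::field) mpoly set \<Rightarrow> nat mono set" where
  "gens n I = (THE G. minimal_monomial_generators n I G)"

text \<open>
  The homomorphism of \<open>\<bbbK>\<close>-algebras with \<open>t\<^sub>u \<mapsto> u\<close>, evaluated term by term. Its image is
  \<open>\<bbbK>[I]\<close>; the kernel does not change if \<open>S\<close> is taken as the codomain.
\<close>

definition toric_map :: "(nat mono, 'k::field) mpoly \<Rightarrow> (nat, 'k) mpoly" where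
  "toric_map p = (\<Sum>m\<in>Poly_Mapping.keys p.
     Poly_Mapping.single 0 (Poly_Mapping.lookup p m) *
     (\<Prod>u\<in>Poly_Mapping.keys m. of_mono u ^ deg_in m u))"

definition toric_ideal :: "nat \<Rightarrow> (nat, 'k::field) mpoly set \<Rightarrow> (nat mono, 'k) mpoly set" where
  "toric_ideal n I = a_kernel (poly_ring (gens n I)) (poly_ring {1..n}) toric_map"


section \<open>Sorting\<close>

text \<open>The list \<open>[i\<^sub>1, i\<^sub>2, \<dots>]\<close> with \<open>i\<^sub>1 \<le> i\<^sub>2 \<le> \<dots>\<close> and \<open>m = x\<^bsub>i\<^sub>1\<^esub> x\<^bsub>i\<^sub>2\<^esub> \<dots>\<close>.\<close>

definition index_list :: "nat mono \<Rightarrow> nat list" where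
  "index_list m = concat (map (\<lambda>i. replicate (deg_in m i) i)
                              (sorted_list_of_set (Poly_Mapping.keys m)))"

text \<open>List positions start at 0, so the indices \<open>i\<^sub>1, i\<^sub>3, \<dots>\<close> are at the even positions.\<close>

definition sort_pair :: "nat mono \<Rightarrow> nat mono \<Rightarrow> nat mono \<times> nat mono" where
  "sort_pair u v =
     (\<Sum>i\<leftarrow>nths (index_list (u + v)) {p. even p}. var i,
      \<Sum>i\<leftarrow>nths (index_list (u + v)) {p. odd p}. var i)"

definition sorted_pair :: "nat mono \<Rightarrow> nat mono \<Rightarrow> bool" where
  "sorted_pair u v \<longleftrightarrow> sort_pair u v = (u, v)"

definition sorting_binomials :: "nat mono set \<Rightarrow> (nat mono, 'k::field) mpoly set" where
  "sorting_binomials G =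
     {of_mono (var u + var v) - of_mono (var u' + var v') | u v u' v'.
        u \<in> G \<and> v \<in> G \<and> sort_pair u v = (u', v') \<and> \<not> sorted_pair u v \<and> \<not> sorted_pair v u}"

text \<open>
  The binomials are required to lie in the toric ideal, hence in the ring with indeterminates
  \<^term>\<open>gens n I\<close>, so the existence of a sorting order forces \<^term>\<open>gens n I\<close> to be sortable.
\<close>

definition sorting_order :: "nat \<Rightarrow> (nat, 'k::field) mpoly set \<Rightarrow> nat mono mono rel \<Rightarrow> bool" where
  "sorting_order n I r \<longleftrightarrow>
     monomial_order (gens n I) r \<and>
     reduced_groebner_basis (gens n I) r (toric_ideal n I) (sorting_binomials (gens n I)) \<and>
     (\<forall>u\<in>gens n I. \<forall>v\<in>gens n I. \<forall>u' v'.
        sort_pair u v = (u', v') \<and> \<not> sorted_pair u v \<and> \<not> sorted_pair v u \<longrightarrow>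
        initial_monomial r
          (of_mono (var u + var v) - of_mono (var u' + var v') :: (nat mono, 'k) mpoly)
        = var u + var v)"


section \<open>The \<open>l\<close>-exchange property\<close>

definition l_exchange_property ::
    "nat \<Rightarrow> (nat, 'k::field) mpoly set \<Rightarrow> nat mono mono rel \<Rightarrow> bool" where
  "l_exchange_property n I r \<longleftrightarrow>
     (\<forall>N (u :: nat \<Rightarrow> nat mono) (v :: nat \<Rightarrow> nat mono) q.
        (\<forall>\<alpha>\<in>{1..N}. u \<alpha> \<in> gens n I \<and> v \<alpha> \<in> gens n I) \<and>
        (\<Sum>\<alpha>=1..N. var (u \<alpha>)) \<in> standard_monomials (gens n I) r (toric_ideal n I) \<and>
        (\<Sum>\<alpha>=1..N. var (v \<alpha>)) \<in> standard_monomials (gens n I) r (toric_ideal n I) \<and>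
        1 \<le> q \<and> q \<le> n - 1 \<and>
        (\<forall>i\<in>{1..<q}. deg_in (\<Sum>\<alpha>=1..N. u \<alpha>) i = deg_in (\<Sum>\<alpha>=1..N. v \<alpha>) i) \<and>
        deg_in (\<Sum>\<alpha>=1..N. u \<alpha>) q < deg_in (\<Sum>\<alpha>=1..N. v \<alpha>) q
        \<longrightarrow> (\<exists>\<alpha>\<in>{1..N}. \<exists>j. q < j \<and> j \<le> n \<and> deg_in (u \<alpha>) j > 0 \<and>
               of_mono (var q + u \<alpha> - var j) \<in> I))"


section \<open>Complete \<open>t\<close>-spread \<open>d\<close>-partite hypergraphs\<close>

text \<open>A hypergraph is the pair of its vertex set and its set of edges.\<close>

type_synonym hypergraph = "nat set \<times> nat set set"

definition spread_edge :: "nat \<Rightarrow> (nat \<Rightarrow> nat) \<Rightarrow> (nat \<Rightarrow> nat set) \<Rightarrow> nat set \<Rightarrow> bool" where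
  "spread_edge d t V e \<longleftrightarrow>
     (\<exists>k. e = k ` {1..d} \<and> (\<forall>j\<in>{1..d}. k j \<in> V j) \<and>
          (\<forall>j\<in>{2..d}. int (k j) - int (k (j - 1)) \<ge> int (t (j - 1))))"

definition complete_spread_hypergraph ::
    "nat \<Rightarrow> (nat \<Rightarrow> nat) \<Rightarrow> (nat \<Rightarrow> nat set) \<Rightarrow> hypergraph" where
  "complete_spread_hypergraph d t V = (\<Union>i\<in>{1..d}. V i, {e. spread_edge d t V e})"

definition no_isolated_vertices :: "hypergraph \<Rightarrow> bool" where
  "no_isolated_vertices H \<longleftrightarrow> (\<forall>x\<in>fst H. \<exists>e\<in>snd H. x \<in> e)"

definition edge_ideal :: "nat \<Rightarrow> hypergraph \<Rightarrow> (nat, 'k::field) mpoly set" where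
  "edge_ideal n H = Idl\<^bsub>poly_ring {1..n}\<^esub> {of_mono (\<Sum>k\<in>e. var k) | e. e \<in> snd H}"

end

theory Submission
  imports Defs
begin

text \<open>
  An edge is a tuple \<open>k\<close> with one entry \<open>k j\<close> in each part \<open>V j\<close>, so a product of \<open>N\<close> edge
  monomials is a table with \<open>N\<close> rows and \<open>d\<close> columns. Since the parts are disjoint, the exponents of
  the product at the indices in \<open>V c\<close> count the entries of column \<open>c\<close>; in particular they determine
  how many entries of column \<open>c\<close> are at most a given bound (\<open>card_column_le\<close>).

  Let \<open>u\<close> and \<open>v\<close> be two such tables whose exponents agree below \<open>q\<close>, and let \<open>v\<close> have the larger
  exponent at \<open>q\<close>. Then \<open>q\<close> lies in some part \<open>V c\<close>, and \<open>v\<close> has more rows than \<open>u\<close> with an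
  entry at most \<open>q\<close> in column \<open>c\<close>. Let \<open>w\<close> be the largest entry that such rows of \<open>v\<close> have in
  column \<open>c - 1\<close> (for \<open>c = 1\<close>, any row of \<open>u\<close> with first entry above \<open>q\<close> will do).
  From \<open>w\<close> one can still step to \<open>q\<close>, that is, \<open>w + t (c - 1) \<le> q\<close>. Column
  \<open>c - 1\<close> lies below \<open>q\<close>, where exponents agree, so \<open>u\<close> and \<open>v\<close> have equally many rows with an
  entry at most \<open>w\<close> there; this number exceeds the number of rows of \<open>u\<close> with an entry at most
  \<open>q\<close> in column \<open>c\<close>. By the pigeonhole principle some row of \<open>u\<close> has an entry at most \<open>w\<close> in
  column \<open>c - 1\<close> and an entry \<open>j > q\<close> in column \<open>c\<close> (\<open>exchangeable_row\<close>). Replacing \<open>j\<close> by \<open>q\<close>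
  in this row respects the spread condition on the left by the choice of \<open>w\<close>, and on the right
  because the entry gets smaller (\<open>spread_tuple_update\<close>).

  The exchange property is about products of minimal generators of the edge ideal. These generators
  are the edge monomials (\<open>gens_edge_ideal\<close>): each of them has exactly one index in each part, so
  none properly divides another.
\<close>

section \<open>Minimal generators of monomial ideals\<close>

text \<open>
  The polynomials all of whose monomials are divisible by an element of \<open>G\<close> form an ideal, which
  contains \<open>G\<close> and therefore the ideal generated by \<open>G\<close>.
\<close>

lemma divisible_if_in_monomial_ideal:
  fixes G :: "'v mono set"
  assumes G: "G \<subseteq> monomials X"
    and m: "(of_mono m :: ('v, 'k::field) mpoly) \<in> Idl\<^bsub>poly_ring X\<^esub> (of_mono ` G)"
  shows "\<exists>g\<in>G. \<exists>c. m = g + c"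
proof -
  let ?R = "poly_ring X :: ('v, 'k) mpoly ring"
  let ?J = "{p :: ('v, 'k) mpoly. Poly_Mapping.keys p \<subseteq> monomials X \<and>
    (\<forall>m\<in>Poly_Mapping.keys p. \<exists>g\<in>G. \<exists>c. m = g + c)}"
  interpret cring ?R by (rule cring_poly_ring)
  have carrier: "carrier ?R = {p. Poly_Mapping.keys p \<subseteq> monomials X}"
    by (simp add: poly_ring_def)
  have minus: "\<ominus>\<^bsub>?R\<^esub> p = - p" if "p \<in> carrier ?R" for p
    by (rule minus_equality) (use that in \<open>auto simp: poly_ring_def\<close>)
  have mult: "x * p \<in> ?J" if p: "p \<in> ?J" and x: "x \<in> carrier ?R" for p x
  proof -
    have "x * p \<in> carrier ?R"
      using m_closed[of x p] p x by (simp add: poly_ring_def)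
    moreover have "\<exists>g\<in>G. \<exists>c. m = g + c" if m: "m \<in> Poly_Mapping.keys (x * p)" for m
    proof -
      obtain a b where "m = a + b" "b \<in> Poly_Mapping.keys p"
        using m keys_mult[of x p] by blast
      with p obtain g c where "g \<in> G" "m = a + (g + c)" by auto
      then show ?thesis by (metis add.left_commute)
    qed
    ultimately show ?thesis by (simp add: carrier)
  qed
  have "ideal ?J ?R"
  proof (rule idealI)
    show "subgroup ?J (add_monoid ?R)"
    proof (rule add.subgroupI)
      show "?J \<subseteq> carrier ?R" by (auto simp: carrier)
      show "?J \<noteq> {}" by (auto intro: exI[of _ 0])
      show "\<ominus>\<^bsub>?R\<^esub> p \<in> ?J" if "p \<in> ?J" for p
        using that minus[of p] by (simp add: carrier)
      show "p \<oplus>\<^bsub>?R\<^esub> p' \<in> ?J" if "p \<in> ?J" "p' \<in> ?J" for p p'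
        using that keys_add[of p p'] by (fastforce simp: poly_ring_def)
    qed
  next
    fix p x assume "p \<in> ?J" "x \<in> carrier ?R"
    then have "x * p \<in> ?J" by (rule mult)
    then show "x \<otimes>\<^bsub>?R\<^esub> p \<in> ?J" "p \<otimes>\<^bsub>?R\<^esub> x \<in> ?J"
      by (simp_all add: poly_ring_def mult.commute)
  qed (rule ring_axioms)
  moreover have "of_mono ` G \<subseteq> ?J"
    using G by (force simp: of_mono_def intro: exI[of _ 0])
  ultimately have "Idl\<^bsub>?R\<^esub> (of_mono ` G) \<subseteq> ?J" by (rule genideal_minimal)
  with m show ?thesis by (auto simp: of_mono_def)
qed

lemma of_mono_in_monomial_ideal:
  fixes G :: "'v mono set"
  assumes "G \<subseteq> monomials X" "m \<in> G"
  shows "(of_mono m :: ('v, 'k::field) mpoly) \<in> Idl\<^bsub>poly_ring X\<^esub> (of_mono ` G)"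
proof -
  interpret cring "poly_ring X :: ('v, 'k) mpoly ring" by (rule cring_poly_ring)
  have "of_mono ` G \<subseteq> carrier (poly_ring X :: ('v, 'k) mpoly ring)"
    using assms(1) by (auto simp: of_mono_def poly_ring_def)
  from genideal_self[OF this] assms(2) show ?thesis by blast
qed

text \<open>
  Monomials none of which properly divides another generate an ideal irredundantly. Any other
  monomial generating set \<open>G\<close> contains them: \<open>e \<in> E\<close> is a multiple of some \<open>g \<in> G\<close>, which in turn
  is a multiple of some \<open>e' \<in> E\<close>, so that \<open>e = g = e'\<close>.
\<close>

lemma gens_monomial_ideal:
  fixes E :: "nat mono set"
  assumes E: "E \<subseteq> monomials {1..n}"
    and antichain: "\<And>e e' c. e \<in> E \<Longrightarrow> e' \<in> E \<Longrightarrow> e = e' + c \<Longrightarrow> c = 0"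
  shows "gens n (Idl\<^bsub>poly_ring {1..n}\<^esub> (of_mono ` E) :: (nat, 'k::field) mpoly set) = E"
proof -
  let ?Idl = "\<lambda>G. Idl\<^bsub>poly_ring {1..n}\<^esub> (of_mono ` G) :: (nat, 'k) mpoly set"
  have "minimal_monomial_generators n (?Idl E) E"
    unfolding minimal_monomial_generators_def
  proof (intro conjI E refl allI impI notI)
    fix G assume G: "G \<subset> E" and eq: "?Idl G = ?Idl E"
    then obtain e where e: "e \<in> E" "e \<notin> G" by blast
    have "of_mono e \<in> ?Idl G"
      unfolding eq using E e(1) by (rule of_mono_in_monomial_ideal)
    then obtain g c where "g \<in> G" "e = g + c"
      using divisible_if_in_monomial_ideal[of G] E G by blast
    with antichain[of e g c] G e show False by auto
  qed
  moreover have "G = E" if "minimal_monomial_generators n (?Idl E) G" for G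
  proof -
    from that have G: "G \<subseteq> monomials {1..n}" and eq: "?Idl G = ?Idl E"
      and minimal: "\<And>G'. G' \<subset> G \<Longrightarrow> ?Idl G' \<noteq> ?Idl E"
      by (auto simp: minimal_monomial_generators_def)
    have "E \<subseteq> G"
    proof
      fix e assume e: "e \<in> E"
      have "of_mono e \<in> ?Idl G"
        unfolding eq using E e by (rule of_mono_in_monomial_ideal)
      then obtain g c where g: "g \<in> G" "e = g + c"
        using divisible_if_in_monomial_ideal[OF G] by blast
      have "of_mono g \<in> ?Idl E"
        unfolding eq[symmetric] using G g(1) by (rule of_mono_in_monomial_ideal)
      then obtain e' c' where e': "e' \<in> E" "g = e' + c'"
        using divisible_if_in_monomial_ideal[OF E] by blast
      have "c' + c = 0"
        by (rule antichain[OF e e'(1)]) (simp add: g e' add.assoc)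
      then have "c = 0" by (auto simp: poly_mapping_eq_iff lookup_add fun_eq_iff)
      with g show "e \<in> G" by simp
    qed
    with minimal[of E] show ?thesis by blast
  qed
  ultimately show ?thesis unfolding gens_def by (rule the_equality)
qed


section \<open>Edges as tuples\<close>

definition spread_tuple :: "nat \<Rightarrow> (nat \<Rightarrow> nat) \<Rightarrow> (nat \<Rightarrow> nat set) \<Rightarrow> (nat \<Rightarrow> nat) \<Rightarrow> bool" where
  "spread_tuple d t V k \<longleftrightarrow>
     (\<forall>j\<in>{1..d}. k j \<in> V j) \<and> (\<forall>j\<in>{2..d}. k (j - 1) + t (j - 1) \<le> k j)"

definition tuple_mono :: "nat \<Rightarrow> (nat \<Rightarrow> nat) \<Rightarrow> nat mono" where
  "tuple_mono d k = (\<Sum>j=1..d. var (k j))"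

lemma spread_edge_iff_tuple:
  "spread_edge d t V e \<longleftrightarrow> (\<exists>k. spread_tuple d t V k \<and> e = k ` {1..d})"
proof -
  have "int (k j) - int (k (j - 1)) \<ge> int (t (j - 1)) \<longleftrightarrow> k (j - 1) + t (j - 1) \<le> k j"
    for k :: "nat \<Rightarrow> nat" and j
    by linarith
  then show ?thesis unfolding spread_edge_def spread_tuple_def by blast
qed

lemma sum_var_edge:
  assumes "disjoint_family_on V {1..d}" "spread_tuple d t V k"
  shows "(\<Sum>i\<in>k ` {1..d}. var i) = tuple_mono d k"
proof -
  have "inj_on k {1..d}"
  proof (rule inj_onI, rule ccontr)
    fix i j assume ij: "i \<in> {1..d}" "j \<in> {1..d}" "k i = k j" "i \<noteq> j"
    then have "V i \<inter> V j = {}" using assms(1) by (simp add: disjoint_family_on_def)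
    moreover have "k i \<in> V i" "k j \<in> V j" using ij(1,2) assms(2) by (simp_all add: spread_tuple_def)
    ultimately show False using ij(3) by auto
  qed
  then show ?thesis by (simp add: tuple_mono_def sum.reindex)
qed

lemma deg_in_tuple_mono:
  assumes V: "disjoint_family_on V {1..d}" and k: "spread_tuple d t V k"
    and c: "c \<in> {1..d}" and x: "x \<in> V c"
  shows "deg_in (tuple_mono d k) x = of_bool (k c = x)"
proof -
  have "k j \<noteq> x" if "j \<in> {1..d}" "j \<noteq> c" for j
  proof -
    have "V j \<inter> V c = {}" using V c that by (simp add: disjoint_family_on_def)
    moreover have "k j \<in> V j" using k that by (simp add: spread_tuple_def)
    ultimately show ?thesis using x by blast
  qed
  then have "deg_in (tuple_mono d k) x = (\<Sum>j=1..d. if j = c then of_bool (k c = x) else 0)"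
    unfolding tuple_mono_def lookup_sum
    by (intro sum.cong) (auto simp: lookup_single when_def)
  also have "\<dots> = of_bool (k c = x)" using c by simp
  finally show ?thesis .
qed

text \<open>
  An edge monomial does not properly divide another: if \<open>e = e' + c\<close>, the entry of \<open>e'\<close> in each
  column has positive exponent in \<open>e\<close>, hence is the only entry that \<open>e\<close> has in that column.
\<close>

lemma gens_edge_ideal:
  fixes t :: "nat \<Rightarrow> nat"
  assumes V: "disjoint_family_on V {1..d}" and Vn: "\<forall>i\<in>{1..d}. V i \<subseteq> {1..n}"
  defines "I \<equiv> edge_ideal n (complete_spread_hypergraph d t V) :: (nat, 'k::field) mpoly set"
    and "E \<equiv> tuple_mono d ` {k. spread_tuple d t V k}"
  shows "gens n I = E" and "\<And>m. m \<in> E \<Longrightarrow> of_mono m \<in> I"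
proof -
  have keys: "E \<subseteq> monomials {1..n}"
  proof
    fix m assume "m \<in> E"
    then obtain k where k: "spread_tuple d t V k" and m: "m = tuple_mono d k"
      by (auto simp: E_def)
    have "Poly_Mapping.keys m \<subseteq> (\<Union>j\<in>{1..d}. Poly_Mapping.keys (var (k j)))"
      unfolding m tuple_mono_def by (rule keys_sum)
    also have "\<dots> \<subseteq> {1..n}" using k Vn by (auto simp: spread_tuple_def)
    finally show "m \<in> monomials {1..n}" by (simp add: monomials_def)
  qed
  have "{of_mono (\<Sum>i\<in>e. var i) :: (nat, 'k) mpoly | e. spread_edge d t V e} = of_mono ` E"
    using sum_var_edge[OF V] by (force simp: spread_edge_iff_tuple E_def)
  then have I: "I = Idl\<^bsub>poly_ring {1..n}\<^esub> (of_mono ` E)"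
    by (simp add: I_def edge_ideal_def complete_spread_hypergraph_def)
  show "of_mono m \<in> I" if "m \<in> E" for m
    unfolding I using keys that by (rule of_mono_in_monomial_ideal)
  have "c = 0" if "e \<in> E" "e' \<in> E" and eq: "e = e' + c" for e e' c
  proof -
    from that obtain k k' where k: "spread_tuple d t V k" "e = tuple_mono d k"
      and k': "spread_tuple d t V k'" "e' = tuple_mono d k'"
      by (auto simp: E_def)
    have "k j = k' j" if j: "j \<in> {1..d}" for j
    proof -
      have x: "k' j \<in> V j" using k'(1) j by (auto simp: spread_tuple_def)
      have "deg_in e (k' j) = deg_in e' (k' j) + deg_in c (k' j)" by (simp add: eq lookup_add)
      then have "of_bool (k j = k' j) = 1 + deg_in c (k' j)"
        by (simp add: k(2) k'(2) deg_in_tuple_mono[OF V k(1) j x] deg_in_tuple_mono[OF V k'(1) j x])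
      then show ?thesis by (cases "k j = k' j") auto
    qed
    then have "e = e'" by (simp add: k k' tuple_mono_def)
    with eq show ?thesis by simp
  qed
  with keys show "gens n I = E" unfolding I by (rule gens_monomial_ideal)
qed


section \<open>Exchange by counting in columns\<close>

lemma card_column_le:
  assumes V: "disjoint_family_on V {1..d}" and fin: "finite A" "finite (V c)"
    and k: "\<forall>\<alpha>\<in>A. spread_tuple d t V (k \<alpha>)" and c: "c \<in> {1..d}"
  shows "card {\<alpha>\<in>A. k \<alpha> c \<le> w} =
    (\<Sum>x\<in>{x\<in>V c. x \<le> w}. deg_in (\<Sum>\<alpha>\<in>A. tuple_mono d (k \<alpha>)) x)"
proof -
  have "card {\<alpha>\<in>A. k \<alpha> c \<le> w} =
      (\<Sum>x\<in>{x\<in>V c. x \<le> w}. \<Sum>\<alpha>\<in>{\<alpha>\<in>{\<alpha>\<in>A. k \<alpha> c \<le> w}. k \<alpha> c = x}. 1)"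
    using fin k c by (subst sum.group) (auto simp: spread_tuple_def)
  also have "\<dots> = (\<Sum>x\<in>{x\<in>V c. x \<le> w}. \<Sum>\<alpha>\<in>A. deg_in (tuple_mono d (k \<alpha>)) x)"
  proof (rule sum.cong)
    fix x assume x: "x \<in> {x \<in> V c. x \<le> w}"
    then have "{\<alpha>\<in>{\<alpha>\<in>A. k \<alpha> c \<le> w}. k \<alpha> c = x} = {\<alpha>\<in>A. k \<alpha> c = x}" by auto
    moreover have "(\<Sum>\<alpha>\<in>A. deg_in (tuple_mono d (k \<alpha>)) x) = (\<Sum>\<alpha>\<in>A. of_bool (k \<alpha> c = x))"
      using deg_in_tuple_mono[OF V _ c] k x by (intro sum.cong) auto
    ultimately show "(\<Sum>\<alpha>\<in>{\<alpha>\<in>{\<alpha>\<in>A. k \<alpha> c \<le> w}. k \<alpha> c = x}. 1) =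
        (\<Sum>\<alpha>\<in>A. deg_in (tuple_mono d (k \<alpha>)) x)"
      using fin(1) by (simp add: sum.If_cases of_bool_def Int_def)
  qed simp
  finally show ?thesis by (simp add: lookup_sum)
qed

text \<open>
  Lowering one entry can only violate the spread condition towards the entry on its left.
\<close>

lemma spread_tuple_update:
  assumes k: "spread_tuple d t V k" and c: "c \<in> {1..d}" and q: "q \<in> V c" "q < k c"
    and left: "2 \<le> c \<Longrightarrow> k (c - 1) + t (c - 1) \<le> q"
  shows "spread_tuple d t V (k(c := q))"
    and "var q + tuple_mono d k - var (k c) = tuple_mono d (k(c := q))"
proof -
  have "(k(c := q)) (j - 1) + t (j - 1) \<le> (k(c := q)) j" if j: "j \<in> {2..d}" for j
  proof -
    have "k (j - 1) + t (j - 1) \<le> k j" using k j by (auto simp: spread_tuple_def)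
    with left q(2) j show ?thesis by (cases "j = c"; cases "j - 1 = c") auto
  qed
  with k q(1) show "spread_tuple d t V (k(c := q))" by (auto simp: spread_tuple_def)
  have split: "tuple_mono d f = var (f c) + (\<Sum>j\<in>{1..d} - {c}. var (f j))" for f
    unfolding tuple_mono_def using c by (intro sum.remove) auto
  have "tuple_mono d (k(c := q)) = var q + (\<Sum>j\<in>{1..d} - {c}. var (k j))"
    unfolding split by (auto intro!: sum.cong)
  then have "var q + tuple_mono d k = var (k c) + tuple_mono d (k(c := q))"
    by (simp only: split[of k] add.left_commute)
  then show "var q + tuple_mono d k - var (k c) = tuple_mono d (k(c := q))"
    by (simp only: add_diff_cancel_left')
qed

text \<open>
  In column \<open>c\<close>, fewer rows of \<open>k\<close> than of \<open>l\<close> have an entry at most \<open>q\<close>, whereas column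
  \<open>c - 1\<close>, if there is one, contains the same entries in both tables. So some row of \<open>k\<close> keeps an entry above \<open>q\<close>
  in column \<open>c\<close> although its entry in column \<open>c - 1\<close> is as small as for those rows of \<open>l\<close>.
\<close>

lemma exchangeable_row:
  assumes V: "disjoint_family_on V {1..d}" and Vn: "\<forall>i\<in>{1..d}. V i \<subseteq> {1..n}"
    and ord: "\<forall>i\<in>{1..d}. \<forall>j\<in>{1..d}. i < j \<longrightarrow> (\<forall>p\<in>V i. \<forall>q\<in>V j. p < q)"
    and A: "finite A"
    and k: "\<forall>\<alpha>\<in>A. spread_tuple d t V (k \<alpha>)" and l: "\<forall>\<alpha>\<in>A. spread_tuple d t V (l \<alpha>)"
    and c: "c \<in> {1..d}" and q: "q \<in> V c"
    and eq: "\<forall>i\<in>{1..<q}. deg_in (\<Sum>\<alpha>\<in>A. tuple_mono d (k \<alpha>)) i =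
                           deg_in (\<Sum>\<alpha>\<in>A. tuple_mono d (l \<alpha>)) i"
    and less: "deg_in (\<Sum>\<alpha>\<in>A. tuple_mono d (k \<alpha>)) q < deg_in (\<Sum>\<alpha>\<in>A. tuple_mono d (l \<alpha>)) q"
  obtains \<alpha> where "\<alpha> \<in> A" "q < k \<alpha> c" "2 \<le> c \<Longrightarrow> k \<alpha> (c - 1) + t (c - 1) \<le> q"
proof -
  define K where "K = {\<alpha>\<in>A. k \<alpha> c \<le> q}"
  define L where "L = {\<alpha>\<in>A. l \<alpha> c \<le> q}"
  have finV: "finite (V i)" if "i \<in> {1..d}" for i
    using Vn that by (meson finite_atLeastAtMost finite_subset)
  note count = card_column_le[OF V A finV]
  have fin: "finite K" "finite L" using A by (auto simp: K_def L_def)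
  have "card K < card L"
    unfolding K_def L_def count[OF c k c] count[OF c l c]
  proof (rule sum_strict_mono_ex1)
    show "finite {x \<in> V c. x \<le> q}" using finV[OF c] by simp
    show "\<exists>x\<in>{x \<in> V c. x \<le> q}. deg_in (\<Sum>\<alpha>\<in>A. tuple_mono d (k \<alpha>)) x
        < deg_in (\<Sum>\<alpha>\<in>A. tuple_mono d (l \<alpha>)) x"
      using q less by auto
    show "\<forall>x\<in>{x \<in> V c. x \<le> q}. deg_in (\<Sum>\<alpha>\<in>A. tuple_mono d (k \<alpha>)) x
        \<le> deg_in (\<Sum>\<alpha>\<in>A. tuple_mono d (l \<alpha>)) x"
    proof
      fix x assume x: "x \<in> {x \<in> V c. x \<le> q}"
      with Vn c have "x \<in> {1..n}" by blast
      with x eq less show "deg_in (\<Sum>\<alpha>\<in>A. tuple_mono d (k \<alpha>)) x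
          \<le> deg_in (\<Sum>\<alpha>\<in>A. tuple_mono d (l \<alpha>)) x"
        by (cases "x = q") auto
    qed
  qed
  show thesis
  proof (cases "2 \<le> c")
    case False
    have "L \<subseteq> A" by (auto simp: L_def)
    with \<open>card K < card L\<close> have "card K < card A"
      by (blast intro: order_less_le_trans card_mono[OF A])
    then have "\<not> A \<subseteq> K" by (auto dest: card_mono[OF fin(1)])
    then obtain \<alpha> where "\<alpha> \<in> A" "\<alpha> \<notin> K" by blast
    with False show thesis by (intro that[of \<alpha>]) (auto simp: K_def)
  next
    case True
    then have c1: "c - 1 \<in> {1..d}" and c2: "c \<in> {2..d}" using c by auto
    \<comment> \<open>The largest entry on the left from which some row of \<open>l\<close> steps to at most \<open>q\<close>.\<close>
    define w where "w = Max ((\<lambda>\<alpha>. l \<alpha> (c - 1)) ` L)"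
    have "L \<noteq> {}" using \<open>card K < card L\<close> by auto
    then have "w \<in> (\<lambda>\<alpha>. l \<alpha> (c - 1)) ` L"
      unfolding w_def using fin by (intro Max_in) auto
    then obtain \<beta> where \<beta>: "\<beta> \<in> A" "l \<beta> c \<le> q" "w = l \<beta> (c - 1)" by (auto simp: L_def)
    have "l \<beta> (c - 1) + t (c - 1) \<le> l \<beta> c"
      using l \<beta>(1) c2 by (simp add: spread_tuple_def)
    with \<beta> have step: "w + t (c - 1) \<le> q" by simp
    have "w \<in> V (c - 1)" using l \<beta> c1 by (simp add: spread_tuple_def)
    then have "w < q" using ord c1 c q True by force
    have "card K < card L" by fact
    also have "L \<subseteq> {\<alpha>\<in>A. l \<alpha> (c - 1) \<le> w}"
      using fin by (auto simp: L_def w_def)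
    then have "card L \<le> card {\<alpha>\<in>A. l \<alpha> (c - 1) \<le> w}"
      using A by (intro card_mono) auto
    also have "card {\<alpha>\<in>A. l \<alpha> (c - 1) \<le> w} = card {\<alpha>\<in>A. k \<alpha> (c - 1) \<le> w}"
      unfolding count[OF c1 k c1] count[OF c1 l c1]
    proof (rule sum.cong)
      fix x assume x: "x \<in> {x \<in> V (c - 1). x \<le> w}"
      with Vn c1 have "x \<in> {1..n}" by blast
      with x \<open>w < q\<close> have "x \<in> {1..<q}" by auto
      with eq show "deg_in (\<Sum>\<alpha>\<in>A. tuple_mono d (l \<alpha>)) x
          = deg_in (\<Sum>\<alpha>\<in>A. tuple_mono d (k \<alpha>)) x" by simp
    qed simp
    finally have "\<not> {\<alpha>\<in>A. k \<alpha> (c - 1) \<le> w} \<subseteq> K"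
      using card_mono[OF fin(1)] by (meson leD)
    then obtain \<alpha> where "\<alpha> \<in> A" "k \<alpha> (c - 1) \<le> w" "\<alpha> \<notin> K" by blast
    with step show thesis by (intro that[of \<alpha>]) (auto simp: K_def)
  qed
qed

theorem theorem3p4:
  fixes n d :: nat and t :: "nat \<Rightarrow> nat" and V :: "nat \<Rightarrow> nat set"
    and I :: "(nat, 'k::field) mpoly set" and r :: "nat mono mono rel"
  assumes "n \<ge> 1" and "d \<ge> 1"
    and "\<forall>i\<in>{1..d-1}. t i \<ge> 1"
    and "\<forall>i\<in>{1..d}. V i \<noteq> {} \<and> V i \<subseteq> {1..n}"
    and "disjoint_family_on V {1..d}"
    and "\<forall>i\<in>{1..d}. \<forall>j\<in>{1..d}. i < j \<longrightarrow> (\<forall>p\<in>V i. \<forall>q\<in>V j. p < q)"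
    and "no_isolated_vertices (complete_spread_hypergraph d t V)"
    and "I = edge_ideal n (complete_spread_hypergraph d t V)"
    and "sorting_order n I r"
  shows "l_exchange_property n I r"
  unfolding l_exchange_property_def
proof (intro allI impI, elim conjE)
  fix N and u v :: "nat \<Rightarrow> nat mono" and q
  assume gens: "\<forall>\<alpha>\<in>{1..N}. u \<alpha> \<in> gens n I \<and> v \<alpha> \<in> gens n I"
    and eq: "\<forall>i\<in>{1..<q}. deg_in (\<Sum>\<alpha>=1..N. u \<alpha>) i = deg_in (\<Sum>\<alpha>=1..N. v \<alpha>) i"
    and less: "deg_in (\<Sum>\<alpha>=1..N. u \<alpha>) q < deg_in (\<Sum>\<alpha>=1..N. v \<alpha>) q"
  note V = assms(5)
  have Vn: "\<forall>i\<in>{1..d}. V i \<subseteq> {1..n}" using assms(4) by blast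
  note edge_gens = gens_edge_ideal[OF V Vn, where 'k = 'k and t = t, folded assms(8)]
  have "\<forall>\<alpha>\<in>{1..N}. \<exists>k. spread_tuple d t V k \<and> u \<alpha> = tuple_mono d k"
    and "\<forall>\<alpha>\<in>{1..N}. \<exists>l. spread_tuple d t V l \<and> v \<alpha> = tuple_mono d l"
    using gens unfolding edge_gens(1) by auto
  then obtain k l
    where k: "\<forall>\<alpha>\<in>{1..N}. spread_tuple d t V (k \<alpha>)" "\<forall>\<alpha>\<in>{1..N}. u \<alpha> = tuple_mono d (k \<alpha>)"
      and l: "\<forall>\<alpha>\<in>{1..N}. spread_tuple d t V (l \<alpha>)" "\<forall>\<alpha>\<in>{1..N}. v \<alpha> = tuple_mono d (l \<alpha>)"
    by metis
  have u: "(\<Sum>\<alpha>=1..N. u \<alpha>) = (\<Sum>\<alpha>=1..N. tuple_mono d (k \<alpha>))"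
    and v: "(\<Sum>\<alpha>=1..N. v \<alpha>) = (\<Sum>\<alpha>=1..N. tuple_mono d (l \<alpha>))"
    using k(2) l(2) by (auto intro: sum.cong)
  obtain c where c: "c \<in> {1..d}" and q: "q \<in> V c"
  proof -
    from less have "(\<Sum>\<alpha>=1..N. \<Sum>j=1..d. deg_in (var (l \<alpha> j)) q) \<noteq> 0"
      unfolding v lookup_sum tuple_mono_def by linarith
    then obtain \<alpha> j where "\<alpha> \<in> {1..N}" "j \<in> {1..d}" "deg_in (var (l \<alpha> j)) q \<noteq> 0"
      by (meson sum.not_neutral_contains_not_neutral)
    with l(1) show thesis
      by (intro that[of j]) (auto simp: spread_tuple_def lookup_single when_def split: if_splits)
  qed
  obtain \<alpha> where \<alpha>: "\<alpha> \<in> {1..N}" "q < k \<alpha> c"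
    and left: "2 \<le> c \<Longrightarrow> k \<alpha> (c - 1) + t (c - 1) \<le> q"
    by (rule exchangeable_row[OF V Vn assms(6) _ k(1) l(1) c q]) (use eq less u v in auto)
  have tuple: "spread_tuple d t V (k \<alpha>)" and u_eq: "u \<alpha> = tuple_mono d (k \<alpha>)"
    using k \<alpha> by auto
  have mem: "k \<alpha> c \<in> V c" using tuple c by (simp add: spread_tuple_def)
  have update: "spread_tuple d t V ((k \<alpha>)(c := q))"
      "var q + tuple_mono d (k \<alpha>) - var (k \<alpha> c) = tuple_mono d ((k \<alpha>)(c := q))"
    using spread_tuple_update[OF tuple c q \<alpha>(2)] left by blast+
  show "\<exists>\<alpha>\<in>{1..N}. \<exists>j>q. j \<le> n \<and> 0 < deg_in (u \<alpha>) j \<and> of_mono (var q + u \<alpha> - var j) \<in> I"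
  proof (intro bexI exI conjI)
    have "k \<alpha> c \<in> {1..n}" using mem Vn c by blast
    then show "k \<alpha> c \<le> n" by simp
    show "0 < deg_in (u \<alpha>) (k \<alpha> c)"
      unfolding u_eq using deg_in_tuple_mono[OF V tuple c mem] by simp
    show "of_mono (var q + u \<alpha> - var (k \<alpha> c)) \<in> I"
      unfolding u_eq update(2) using update(1) by (intro edge_gens(2)) simp
  qed (use \<alpha> in auto)
qed

end
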